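(* Let $\mathcal A$ be an associative algebra over $\mathbb C$ with a modified double Poisson bracket $\{\!\!\{\_,\_\}\!\!\}$. Let $\mathcal M$ be a coassociative counital coalgebra equipped with a bilinear form $\nu$ and a trace element $\tau$ as in the context, and let $\{\_,\_\}^{\mathcal M}$ be the induced biderivation of the representation algebra $\mathcal A_{\mathcal M}$. Then the restriction $$\{\_,\_\}^{\mathcal M}:\ \mathcal A_\tau\otimes\mathcal A_{\mathcal M}\to\mathcal A_{\mathcal M}$$ satisfies the Jacobi identity for a left Loday bracket, namely for all $\alpha\in\mathcal M$ and $a,b,c\in\mathcal A$: $$\{a_\tau,\{b_\tau,c_\alpha\}^{\mathcal M}\}^{\mathcal M}-\{b_\tau,\{a_\tau,c_\alpha\}^{\mathcal M}\}^{\mathcal M}=\{\{a_\tau,b_\tau\}^{\mathcal M},c_\alpha\}^{\mathcal M}.$$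
   Context: Everything is over $\mathbb C$. A modified double Poisson bracket on $\mathcal A$ is a linear map $\{\!\!\{\_\}\!\!\}:\mathcal A\otimes\mathcal A\to\mathcal A\otimes\mathcal A$, written $\{\!\!\{a,b\}\!\!\}=\{\!\!\{a,b\}\!\!\}'\otimes\{\!\!\{a,b\}\!\!\}''$ (sum suppressed), such that, with $\{\_,\_\}:=\mu\circ\{\!\!\{\_,\_\}\!\!\}$ ($\mu$ the multiplication), for all $a,b,c\in\mathcal A$: (1) $\{\!\!\{a,bc\}\!\!\}=(b\otimes 1)\{\!\!\{a,c\}\!\!\}+\{\!\!\{a,b\}\!\!\}(1\otimes c)$; (2) $\{\!\!\{ab,c\}\!\!\}=(1\otimes a)\{\!\!\{b,c\}\!\!\}+\{\!\!\{a,c\}\!\!\}(b\otimes 1)$; (3) $\{a,\{b,c\}\}-\{b,\{a,c\}\}=\{\{a,b\},c\}$; (4) $\{a,b\}+\{b,a\}\in[\mathcal A,\mathcal A]$, the span of commutators. Coalgebra data: $\mathcal M$ is a coassociative coalgebra with comultiplication $\Delta$ and counit $\epsilon$; iterated comultiplications are written $\Delta^m(\alpha)=\alpha^1\otimes\dots\otimes\alpha^m$ (sum suppressed). It is equipped with a bilinear form $\nu:\mathcal M\otimes\mathcal M\to\mathbb C$ such that $\nu(\alpha,\beta^2)\,\beta^1\otimes\beta^3=\nu(\beta,\alpha^2)\,\alpha^3\otimes\alpha^1$ for all $\alpha,\beta\in\mathcal M$, and an element $\tau\in\mathcal M$ with $\nu(\tau,\alpha)=\epsilon(\alpha)$ for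 all $\alpha\in\mathcal M$. The representation algebra $\mathcal A_{\mathcal M}$ is the commutative algebra generated by symbols $a_\alpha$ ($a\in\mathcal A$, $\alpha\in\mathcal M$) that are bilinear in $(a,\alpha)$, subject to $(ab)_\alpha=a_{\alpha^1}b_{\alpha^2}$. The induced bracket $\{\_,\_\}^{\mathcal M}$ is the biderivation of $\mathcal A_{\mathcal M}$ (Leibniz rule in each argument) with $\{a_\alpha,b_\beta\}^{\mathcal M}=\nu(\alpha,\beta^2)\,\{\!\!\{a,b\}\!\!\}'_{\beta^1}\{\!\!\{a,b\}\!\!\}''_{\beta^3}$. $\mathcal A_\tau=\{a_\tau: a\in\mathcal A\}\subset\mathcal A_{\mathcal M}$. *)

theory Defs
  imports Complex_Main "HOL-Library.Poly_Mapping"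
begin

section \<open>Complex vector spaces and algebras\<close>

class scaleC =
  fixes scaleC :: "complex \<Rightarrow> 'a \<Rightarrow> 'a"  (infixr \<open>*\<^sub>C\<close> 75)

class complex_vector = scaleC + ab_group_add +
  assumes scaleC_add_right: "c *\<^sub>C (x + y) = c *\<^sub>C x + c *\<^sub>C y"
    and scaleC_add_left: "(c + d) *\<^sub>C x = c *\<^sub>C x + d *\<^sub>C x"
    and scaleC_scaleC: "c *\<^sub>C d *\<^sub>C x = (c * d) *\<^sub>C x"
    and scaleC_one: "1 *\<^sub>C x = x"

text \<open>Algebras are associative and not assumed to be unital; in the unital case the type is
  also of class \<^class>\<open>monoid_mult\<close>.\<close>

class complex_algebra = complex_vector + ring +
  assumes mult_scaleC_left: "(c *\<^sub>C x) * y = c *\<^sub>C (x * y)"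
    and mult_scaleC_right: "x * (c *\<^sub>C y) = c *\<^sub>C (x * y)"

instantiation complex :: complex_algebra
begin
definition scaleC_complex :: "complex \<Rightarrow> complex \<Rightarrow> complex"
  where "scaleC_complex = (*)"
instance by standard (simp_all add: scaleC_complex_def algebra_simps)
end

lemma vector_space_scaleC: "vector_space (scaleC :: complex \<Rightarrow> 'a \<Rightarrow> 'a::complex_vector)"
  by unfold_locales (simp_all add: scaleC_add_right scaleC_add_left scaleC_scaleC scaleC_one)

abbreviation clinear :: "('a::complex_vector \<Rightarrow> 'b::complex_vector) \<Rightarrow> bool"
  where "clinear \<equiv> Vector_Spaces.linear scaleC scaleC"

abbreviation cspan :: "'a::complex_vector set \<Rightarrow> 'a set"
  where "cspan \<equiv> module.span scaleC"

definition cbilinear :: "('a::complex_vector \<Rightarrow> 'b::complex_vector \<Rightarrow> 'c::complex_vector) \<Rightarrow> bool"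
  where "cbilinear f \<longleftrightarrow> (\<forall>x. clinear (f x)) \<and> (\<forall>y. clinear (\<lambda>x. f x y))"

lemma clinear_iff:
  "clinear f \<longleftrightarrow> (\<forall>x y. f (x + y) = f x + f y) \<and> (\<forall>c x. f (c *\<^sub>C x) = c *\<^sub>C f x)"
  by (simp add: Vector_Spaces.linear_iff vector_space_scaleC vector_space_pair_def)


section \<open>Tensor products of complex vector spaces\<close>

abbreviation free_scale :: "complex \<Rightarrow> ('k \<Rightarrow>\<^sub>0 complex) \<Rightarrow> ('k \<Rightarrow>\<^sub>0 complex)"
  where "free_scale c \<equiv> Poly_Mapping.map ((*) c)"

lemma lookup_free_scale [simp]:
  "Poly_Mapping.lookup (free_scale c p) k = c * Poly_Mapping.lookup p k"
  by (simp add: Poly_Mapping.map.rep_eq when_def)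

lemma vector_space_free_scale: "vector_space free_scale"
  by unfold_locales (auto intro!: poly_mapping_eqI simp: lookup_add algebra_simps)

lemma module_free_scale: "module free_scale"
  using vector_space_free_scale by (simp add: module_iff_vector_space)

definition tensor_relators ::
    "(('a::complex_vector \<times> 'b::complex_vector) \<Rightarrow>\<^sub>0 complex) set" where
  "tensor_relators =
     {Poly_Mapping.single (x + x', y) 1 - Poly_Mapping.single (x, y) 1
        - Poly_Mapping.single (x', y) 1 | x x' y. True} \<union>
     {Poly_Mapping.single (x, y + y') 1 - Poly_Mapping.single (x, y) 1
        - Poly_Mapping.single (x, y') 1 | x y y'. True} \<union>
     {Poly_Mapping.single (c *\<^sub>C x, y) 1 - Poly_Mapping.single (x, y) c | c x y. True} \<union>
     {Poly_Mapping.single (x, c *\<^sub>C y) 1 - Poly_Mapping.single (x, y) c | c x y. True}"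

definition tensor_rel ::
    "(('a::complex_vector \<times> 'b::complex_vector) \<Rightarrow>\<^sub>0 complex) \<Rightarrow> (('a \<times> 'b) \<Rightarrow>\<^sub>0 complex) \<Rightarrow> bool"
  where "tensor_rel p q \<longleftrightarrow> p - q \<in> module.span free_scale tensor_relators"

lemma diff_diff_add_diff: "(a - b) - (c - d) = (a - c) - (b - d)" for a :: "'a::ab_group_add"
  by (simp add: algebra_simps)

lemma equivp_module_span:
  assumes "module s"
  shows "equivp (\<lambda>p q. p - q \<in> module.span s S)"
proof -
  interpret module s by fact
  have "p - q \<in> span S \<Longrightarrow> q - p \<in> span S" for p q
    using span_neg[of "p - q" S] by simp
  moreover have "p - q \<in> span S \<Longrightarrow> q - r \<in> span S \<Longrightarrow> p - r \<in> span S" for p q r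
    using span_add[of "p - q" S "q - r"] by simp
  ultimately show ?thesis
    by (intro equivpI reflpI sympI transpI) (simp add: span_zero, blast, blast)
qed

quotient_type (overloaded) ('a, 'b) tensor =
    "('a::complex_vector \<times> 'b::complex_vector) \<Rightarrow>\<^sub>0 complex" / tensor_rel
  unfolding tensor_rel_def[abs_def] by (intro equivp_module_span module_free_scale)

instantiation tensor :: (complex_vector, complex_vector) complex_vector
begin

lift_definition zero_tensor :: "('a, 'b) tensor" is 0 .

lift_definition plus_tensor :: "('a, 'b) tensor \<Rightarrow> ('a, 'b) tensor \<Rightarrow> ('a, 'b) tensor" is "(+)"
  unfolding tensor_rel_def
  by (metis add_diff_add module.span_add[OF module_free_scale])

lift_definition uminus_tensor :: "('a, 'b) tensor \<Rightarrow> ('a, 'b) tensor" is uminus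
  unfolding tensor_rel_def
  by (metis minus_diff_minus module.span_neg[OF module_free_scale])

lift_definition minus_tensor :: "('a, 'b) tensor \<Rightarrow> ('a, 'b) tensor \<Rightarrow> ('a, 'b) tensor" is "(-)"
  unfolding tensor_rel_def
  by (metis diff_diff_add_diff module.span_diff[OF module_free_scale])

lift_definition scaleC_tensor :: "complex \<Rightarrow> ('a, 'b) tensor \<Rightarrow> ('a, 'b) tensor" is free_scale
  unfolding tensor_rel_def
  by (metis module.span_scale[OF module_free_scale] module.scale_right_diff_distrib[OF module_free_scale])

instance
proof
  have refl: "tensor_rel p p" for p :: "('a \<times> 'b) \<Rightarrow>\<^sub>0 complex"
    using tensor_equivp by (rule equivp_reflp)
  note vs = vector_space.vector_space_assms[OF vector_space_free_scale]
  fix x y z :: "('a, 'b) tensor" and c d :: complex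
  show "x + y + z = x + (y + z)" by transfer (simp add: refl add.assoc)
  show "x + y = y + x" by transfer (simp add: refl add.commute)
  show "0 + x = x" by transfer (simp add: refl)
  show "- x + x = 0" by transfer (simp add: refl)
  show "x - y = x + - y" by transfer (simp add: refl)
  show "c *\<^sub>C (x + y) = c *\<^sub>C x + c *\<^sub>C y" by transfer (simp only: refl vs)
  show "(c + d) *\<^sub>C x = c *\<^sub>C x + d *\<^sub>C x" by transfer (simp only: refl vs)
  show "c *\<^sub>C d *\<^sub>C x = (c * d) *\<^sub>C x" by transfer (simp only: refl vs)
  show "1 *\<^sub>C x = x" by transfer (simp only: refl vs)
qed

end

lift_definition pure_tensor ::
    "'a::complex_vector \<Rightarrow> 'b::complex_vector \<Rightarrow> ('a, 'b) tensor"  (infixr \<open>\<otimes>\<close> 72)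
  is "\<lambda>x y. Poly_Mapping.single (x, y) 1" .

definition free_extend :: "('a \<Rightarrow> 'b \<Rightarrow> 'c::complex_vector) \<Rightarrow> ('a \<times> 'b \<Rightarrow>\<^sub>0 complex) \<Rightarrow> 'c"
  where "free_extend f p =
    (\<Sum>k\<in>Poly_Mapping.keys p. Poly_Mapping.lookup p k *\<^sub>C f (fst k) (snd k))"

text \<open>\<open>tensor_lift f\<close> is the linear map induced by a bilinear \<open>f\<close>; it plays the role of
  Sweedler notation. It depends on a choice of representatives, and hence is meaningful,
  for bilinear \<open>f\<close> only; see \<open>tensor_lift_pure\<close> and \<open>clinear_tensor_lift\<close> below.\<close>

definition tensor_lift ::
    "('a::complex_vector \<Rightarrow> 'b::complex_vector \<Rightarrow> 'c::complex_vector) \<Rightarrow> ('a, 'b) tensor \<Rightarrow> 'c"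
  where "tensor_lift f t = free_extend f (rep_tensor t)"

lemma free_extend_superset:
  assumes "finite K" "Poly_Mapping.keys p \<subseteq> K"
  shows "free_extend f p = (\<Sum>k\<in>K. Poly_Mapping.lookup p k *\<^sub>C f (fst k) (snd k))"
  unfolding free_extend_def using assms
  by (intro sum.mono_neutral_left)
    (auto simp: in_keys_iff module.scale_zero_left[OF vector_space_scaleC[folded module_iff_vector_space]])

lemma linear_free_extend: "Vector_Spaces.linear free_scale scaleC (free_extend f)"
proof -
  have m: "module (scaleC :: complex \<Rightarrow> 'c \<Rightarrow> 'c)"
    using vector_space_scaleC by (simp add: module_iff_vector_space)
  have "free_extend f (p + q) = free_extend f p + free_extend f q" for p q
  proof -
    let ?K = "Poly_Mapping.keys p \<union> Poly_Mapping.keys q"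
    have "Poly_Mapping.keys (p + q) \<subseteq> ?K" by (rule keys_add)
    then show ?thesis
      by (simp add: free_extend_superset[of ?K] lookup_add scaleC_add_left sum.distrib)
  qed
  moreover have "free_extend f (free_scale c p) = c *\<^sub>C free_extend f p" for c p
  proof -
    have "Poly_Mapping.keys (free_scale c p) \<subseteq> Poly_Mapping.keys p"
      by (auto simp: in_keys_iff)
    then show ?thesis
      by (simp add: free_extend_superset[of "Poly_Mapping.keys p"] module.scale_sum_right[OF m]
          scaleC_scaleC)
  qed
  ultimately show ?thesis
    by (simp add: Vector_Spaces.linear_iff vector_space_free_scale vector_space_scaleC
        vector_space_pair_def)
qed

lemma free_extend_single: "free_extend f (Poly_Mapping.single (x, y) c) = c *\<^sub>C f x y"
  by (subst free_extend_superset[of "{(x, y)}"]) auto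

lemma free_extend_cong:
  assumes f: "cbilinear f" and pq: "tensor_rel p q"
  shows "free_extend f p = free_extend f q"
proof -
  interpret Vector_Spaces.linear free_scale scaleC "free_extend f" by (rule linear_free_extend)
  have "free_extend f (p - q) = 0"
  proof (rule eq_0_on_span[where b = tensor_relators])
    show "p - q \<in> module.span free_scale tensor_relators"
      using pq by (simp add: tensor_rel_def)
    fix r assume "r \<in> (tensor_relators :: ('a \<times> 'b \<Rightarrow>\<^sub>0 complex) set)"
    then show "free_extend f r = 0"
      using f by (auto simp: tensor_relators_def diff free_extend_single cbilinear_def clinear_iff
          scaleC_one)
  qed
  then show ?thesis by (simp add: diff)
qed

lemma tensor_lift_abs:
  assumes "cbilinear f"
  shows "tensor_lift f (abs_tensor p) = free_extend f p"
  unfolding tensor_lift_def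
  by (rule free_extend_cong[OF assms]) (rule rep_abs_rsp_left[OF Quotient3_tensor, OF equivp_reflp[OF tensor_equivp]])

lemma tensor_lift_pure:
  assumes "cbilinear f"
  shows "tensor_lift f (x \<otimes> y) = f x y"
  by (simp add: pure_tensor.abs_eq tensor_lift_abs[OF assms] free_extend_single scaleC_one)

lemma clinear_tensor_lift:
  assumes "cbilinear f"
  shows "clinear (tensor_lift f)"
proof -
  interpret Vector_Spaces.linear free_scale scaleC "free_extend f" by (rule linear_free_extend)
  have "tensor_lift f (s + t) = tensor_lift f s + tensor_lift f t" for s t
    by (induct s; induct t) (simp add: plus_tensor.abs_eq tensor_lift_abs[OF assms] add)
  moreover have "tensor_lift f (c *\<^sub>C t) = c *\<^sub>C tensor_lift f t" for c t
    by (induct t) (simp add: scaleC_tensor.abs_eq tensor_lift_abs[OF assms] scale)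
  ultimately show ?thesis by (simp add: clinear_iff)
qed

lemma cbilinear_pure_tensor: "cbilinear (\<otimes>)"
  unfolding cbilinear_def clinear_iff
proof (intro conjI allI)
  have scale: "free_scale c (Poly_Mapping.single k 1) = Poly_Mapping.single k c" for c and k :: "'a \<times> 'b"
    by (rule poly_mapping_eqI) (simp add: lookup_single when_def)
  note base = module.span_base[OF module_free_scale]
  fix x x' :: 'a and y y' :: 'b and c :: complex
  show "x \<otimes> (y + y') = x \<otimes> y + x \<otimes> y'" "(x + x') \<otimes> y = x \<otimes> y + x' \<otimes> y"
    by (transfer, unfold tensor_rel_def, intro base,
        force simp: tensor_relators_def diff_diff_eq)+
  show "x \<otimes> (c *\<^sub>C y) = c *\<^sub>C (x \<otimes> y)" "(c *\<^sub>C x) \<otimes> y = c *\<^sub>C (x \<otimes> y)"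
    by (transfer, unfold tensor_rel_def scale, intro base,
        force simp: tensor_relators_def)+
qed

lemma tensor_sum_list_pure: "\<exists>s. (\<Sum>(x, y)\<leftarrow>s. x \<otimes> y) = t"
proof -
  have single: "(c *\<^sub>C x) \<otimes> y = abs_tensor (Poly_Mapping.single (x, y) c)" for c and x :: 'a and y :: 'b
    unfolding pure_tensor.abs_eq tensor.abs_eq_iff tensor_rel_def
    by (intro module.span_base[OF module_free_scale], force simp: tensor_relators_def)
  have "\<exists>s. (\<Sum>(x, y)\<leftarrow>s. x \<otimes> y) = abs_tensor p" for p :: "'a \<times> 'b \<Rightarrow>\<^sub>0 complex"
  proof (induct p rule: update_induct)
    case const
    show ?case by (intro exI[of _ "[]"]) (simp add: zero_tensor_def)
  next
    case (update p k c)
    then obtain s where s: "(\<Sum>(x, y)\<leftarrow>s. x \<otimes> y) = abs_tensor p" by blast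
    have "Poly_Mapping.update k c p = Poly_Mapping.single k c + p"
      using update by (intro poly_mapping_eqI) (auto simp: lookup_update lookup_add lookup_single when_def in_keys_iff)
    then show ?case
      using s by (intro exI[of _ "(c *\<^sub>C fst k, snd k) # s"]) (simp add: single plus_tensor.abs_eq)
  qed
  then show ?thesis by (metis Quotient3_abs_rep[OF Quotient3_tensor])
qed

definition tensor_map ::
    "('a::complex_vector \<Rightarrow> 'c::complex_vector) \<Rightarrow> ('b::complex_vector \<Rightarrow> 'd::complex_vector)
      \<Rightarrow> ('a, 'b) tensor \<Rightarrow> ('c, 'd) tensor"
  where "tensor_map f g = tensor_lift (\<lambda>x y. f x \<otimes> g y)"

definition tensor_lift3 ::
    "('a::complex_vector \<Rightarrow> 'b::complex_vector \<Rightarrow> 'c::complex_vector \<Rightarrow> 'd::complex_vector)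
      \<Rightarrow> ('a, ('b, 'c) tensor) tensor \<Rightarrow> 'd"
  where "tensor_lift3 f = tensor_lift (\<lambda>x. tensor_lift (f x))"

definition tensor_assoc ::
    "(('a::complex_vector, 'b::complex_vector) tensor, 'c::complex_vector) tensor
      \<Rightarrow> ('a, ('b, 'c) tensor) tensor"
  where "tensor_assoc = tensor_lift (\<lambda>t z. tensor_lift (\<lambda>x y. x \<otimes> (y \<otimes> z)) t)"


section \<open>Modified double Poisson brackets\<close>

definition single_bracket ::
    "(('a::complex_algebra, 'a) tensor \<Rightarrow> ('a, 'a) tensor) \<Rightarrow> 'a \<Rightarrow> 'a \<Rightarrow> 'a"
  where "single_bracket D a b = tensor_lift (*) (D (a \<otimes> b))"

text \<open>Multiplication by \<open>b \<otimes> 1\<close> or \<open>1 \<otimes> b\<close> on the left or right is written as the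
  corresponding multiplication operator on one tensor factor, so that no unit is needed.\<close>

locale modified_double_poisson_bracket =
  fixes D :: "('a::complex_algebra, 'a) tensor \<Rightarrow> ('a, 'a) tensor"
  assumes linear: "clinear D"
    and leibniz_right: "D (a \<otimes> (b * c)) =
          tensor_map (\<lambda>x. b * x) (\<lambda>y. y) (D (a \<otimes> c)) + tensor_map (\<lambda>x. x) (\<lambda>y. y * c) (D (a \<otimes> b))"
    and leibniz_left: "D ((a * b) \<otimes> c) =
          tensor_map (\<lambda>x. x) (\<lambda>y. a * y) (D (b \<otimes> c)) + tensor_map (\<lambda>x. x * b) (\<lambda>y. y) (D (a \<otimes> c))"
    and jacobi: "single_bracket D a (single_bracket D b c) - single_bracket D b (single_bracket D a c)
          = single_bracket D (single_bracket D a b) c"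
    and skew: "single_bracket D a b + single_bracket D b a \<in> cspan {x * y - y * x | x y. True}"


section \<open>Coalgebras\<close>

text \<open>The operations are declared in a class of their own because the laws involve the
  \<^class>\<open>complex_vector\<close> structure of tensor products of the class type with itself.\<close>

class coalgebra_ops =
  fixes comult :: "'a::complex_vector \<Rightarrow> ('a, 'a) tensor"
    and counit :: "'a::complex_vector \<Rightarrow> complex"

class complex_coalgebra = complex_vector + coalgebra_ops +
  assumes clinear_comult: "clinear comult"
    and clinear_counit: "clinear counit"
    and coassoc: "tensor_assoc (tensor_map comult (\<lambda>y. y) (comult \<alpha>))
          = tensor_map (\<lambda>x. x) comult (comult \<alpha>)"
    and counit_left: "tensor_lift (\<lambda>x y. counit x *\<^sub>C y) (comult \<alpha>) = \<alpha>"
    and counit_right: "tensor_lift (\<lambda>x y. counit y *\<^sub>C x) (comult \<alpha>) = \<alpha>"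

definition comult3 :: "'m::complex_coalgebra \<Rightarrow> ('m, ('m, 'm) tensor) tensor"
  where "comult3 \<alpha> = tensor_map (\<lambda>x. x) comult (comult \<alpha>)"

locale coalgebra_form =
  fixes \<nu> :: "'m::complex_coalgebra \<Rightarrow> 'm \<Rightarrow> complex" and \<tau> :: 'm
  assumes bilinear: "cbilinear \<nu>"
    and exchange: "tensor_lift3 (\<lambda>\<beta>1 \<beta>2 \<beta>3. \<nu> \<alpha> \<beta>2 *\<^sub>C (\<beta>1 \<otimes> \<beta>3)) (comult3 \<beta>)
          = tensor_lift3 (\<lambda>\<alpha>1 \<alpha>2 \<alpha>3. \<nu> \<beta> \<alpha>2 *\<^sub>C (\<alpha>3 \<otimes> \<alpha>1)) (comult3 \<alpha>)"
    and trace: "\<nu> \<tau> \<alpha> = counit \<alpha>"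


section \<open>The representation algebra\<close>

text \<open>Polynomials over \<open>\<complex>\<close> in the indeterminates \<open>'v\<close>.\<close>

type_synonym 'v cpoly = "('v \<Rightarrow>\<^sub>0 nat) \<Rightarrow>\<^sub>0 complex"

definition cpoly_var :: "'v \<Rightarrow> 'v cpoly"
  where "cpoly_var v = Poly_Mapping.single (Poly_Mapping.single v 1) 1"

definition cpoly_const :: "complex \<Rightarrow> 'v cpoly"
  where "cpoly_const c = Poly_Mapping.single 0 c"

text \<open>In the last family of relators a list \<open>s\<close> stands for an expression of \<open>comult \<alpha>\<close> as a
  finite sum \<open>\<Sum> \<alpha>1 \<otimes> \<alpha>2\<close>; all such expressions are included.\<close>

definition rep_relators :: "('a::complex_algebra \<times> 'm::complex_coalgebra) cpoly set" where
  "rep_relators =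
     {cpoly_var (a + b, \<alpha>) - cpoly_var (a, \<alpha>) - cpoly_var (b, \<alpha>) | a b \<alpha>. True} \<union>
     {cpoly_var (a, \<alpha> + \<beta>) - cpoly_var (a, \<alpha>) - cpoly_var (a, \<beta>) | a \<alpha> \<beta>. True} \<union>
     {cpoly_var (c *\<^sub>C a, \<alpha>) - cpoly_const c * cpoly_var (a, \<alpha>) | c a \<alpha>. True} \<union>
     {cpoly_var (a, c *\<^sub>C \<alpha>) - cpoly_const c * cpoly_var (a, \<alpha>) | c a \<alpha>. True} \<union>
     {cpoly_var (a * b, \<alpha>) - (\<Sum>(\<alpha>1, \<alpha>2)\<leftarrow>s. cpoly_var (a, \<alpha>1) * cpoly_var (b, \<alpha>2)) | a b \<alpha> s.
        (\<Sum>(\<alpha>1, \<alpha>2)\<leftarrow>s. \<alpha>1 \<otimes> \<alpha>2) = comult \<alpha>}"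

text \<open>The span of a subset of a commutative ring, seen as a module over itself, is the
  ideal generated by the subset.\<close>

definition rep_rel :: "('a::complex_algebra \<times> 'm::complex_coalgebra) cpoly \<Rightarrow> ('a \<times> 'm) cpoly \<Rightarrow> bool"
  where "rep_rel p q \<longleftrightarrow> p - q \<in> module.span (*) rep_relators"

lemma module_mult: "module ((*) :: 'r::comm_ring_1 \<Rightarrow> 'r \<Rightarrow> 'r)"
  by unfold_locales (simp_all add: algebra_simps)

quotient_type (overloaded) ('a, 'm) rep_alg =
    "('a::complex_algebra \<times> 'm::complex_coalgebra) cpoly" / rep_rel
  unfolding rep_rel_def[abs_def] by (intro equivp_module_span module_mult)

instantiation rep_alg :: (complex_algebra, complex_coalgebra) "{comm_ring, comm_monoid_mult, complex_algebra}"
begin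

lift_definition zero_rep_alg :: "('a, 'b) rep_alg" is 0 .

lift_definition one_rep_alg :: "('a, 'b) rep_alg" is 1 .

lift_definition plus_rep_alg :: "('a, 'b) rep_alg \<Rightarrow> ('a, 'b) rep_alg \<Rightarrow> ('a, 'b) rep_alg" is "(+)"
  unfolding rep_rel_def
  by (metis add_diff_add module.span_add[OF module_mult])

lift_definition uminus_rep_alg :: "('a, 'b) rep_alg \<Rightarrow> ('a, 'b) rep_alg" is uminus
  unfolding rep_rel_def
  by (metis minus_diff_minus module.span_neg[OF module_mult])

lift_definition minus_rep_alg :: "('a, 'b) rep_alg \<Rightarrow> ('a, 'b) rep_alg \<Rightarrow> ('a, 'b) rep_alg" is "(-)"
  unfolding rep_rel_def
  by (metis diff_diff_add_diff module.span_diff[OF module_mult])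

lift_definition times_rep_alg :: "('a, 'b) rep_alg \<Rightarrow> ('a, 'b) rep_alg \<Rightarrow> ('a, 'b) rep_alg" is "(*)"
proof (unfold rep_rel_def)
  fix p p' q q' :: "('a \<times> 'b) cpoly"
  assume p: "p - p' \<in> module.span (*) rep_relators" and q: "q - q' \<in> module.span (*) rep_relators"
  have "p * q - p' * q' = q * (p - p') + p' * (q - q')"
    by (simp add: algebra_simps)
  then show "p * q - p' * q' \<in> module.span (*) rep_relators"
    using p q by (simp only: module.span_add[OF module_mult] module.span_scale[OF module_mult])
qed

lift_definition scaleC_rep_alg :: "complex \<Rightarrow> ('a, 'b) rep_alg \<Rightarrow> ('a, 'b) rep_alg"
  is "\<lambda>c p. cpoly_const c * p"
  unfolding rep_rel_def
  by (metis module.span_scale[OF module_mult] right_diff_distrib)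

instance
proof
  have refl: "rep_rel p p" for p :: "('a \<times> 'b) cpoly"
    using rep_alg_equivp by (rule equivp_reflp)
  have const: "cpoly_const (c + d) = cpoly_const c + cpoly_const d"
      "cpoly_const (c * d) = cpoly_const c * cpoly_const d"
      "cpoly_const 1 = 1" for c d :: complex
    by (simp_all add: cpoly_const_def single_add mult_single)
  fix x y z :: "('a, 'b) rep_alg" and c d :: complex
  show "x + y + z = x + (y + z)" by transfer (simp add: refl add.assoc)
  show "x + y = y + x" by transfer (simp add: refl add.commute)
  show "0 + x = x" by transfer (simp add: refl)
  show "- x + x = 0" by transfer (simp add: refl)
  show "x - y = x + - y" by transfer (simp add: refl)
  show "x * y * z = x * (y * z)" by transfer (simp add: refl mult.assoc)
  show "x * y = y * x" by transfer (simp add: refl mult.commute)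
  show "1 * x = x" by transfer (simp add: refl)
  show "x * (y + z) = x * y + x * z" by transfer (simp add: refl distrib_left)
  show "(x + y) * z = x * z + y * z" by transfer (simp add: refl distrib_right)
  show "c *\<^sub>C (x + y) = c *\<^sub>C x + c *\<^sub>C y" by transfer (simp add: refl distrib_left)
  show "(c + d) *\<^sub>C x = c *\<^sub>C x + d *\<^sub>C x" by transfer (simp add: refl const distrib_right)
  show "c *\<^sub>C d *\<^sub>C x = (c * d) *\<^sub>C x" by transfer (simp add: refl const mult.assoc)
  show "1 *\<^sub>C x = x" by transfer (simp add: refl const)
  show "(c *\<^sub>C x) * y = c *\<^sub>C (x * y)" by transfer (simp add: refl mult.assoc)
  show "x * (c *\<^sub>C y) = c *\<^sub>C (x * y)" by transfer (simp add: refl mult.left_commute)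
qed

end

text \<open>The generator \<open>a\<^sub>\<alpha>\<close>.\<close>

lift_definition rep_gen :: "'a::complex_algebra \<Rightarrow> 'm::complex_coalgebra \<Rightarrow> ('a, 'm) rep_alg"
  is "\<lambda>a \<alpha>. cpoly_var (a, \<alpha>)" .

lemma cbilinear_rep_gen: "cbilinear rep_gen"
  unfolding cbilinear_def clinear_iff
proof (intro conjI allI)
  note base = module.span_base[OF module_mult]
  fix a b :: 'a and \<alpha> \<beta> :: 'b and c :: complex
  show "rep_gen a (\<alpha> + \<beta>) = rep_gen a \<alpha> + rep_gen a \<beta>" "rep_gen (a + b) \<alpha> = rep_gen a \<alpha> + rep_gen b \<alpha>"
    by (transfer, unfold rep_rel_def, intro base,
        force simp: rep_relators_def diff_diff_eq)+
  show "rep_gen a (c *\<^sub>C \<alpha>) = c *\<^sub>C rep_gen a \<alpha>" "rep_gen (c *\<^sub>C a) \<alpha> = c *\<^sub>C rep_gen a \<alpha>"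
    by (transfer, unfold rep_rel_def, intro base,
        force simp: rep_relators_def)+
qed

lemma rep_gen_mult:
  fixes a b :: "'a::complex_algebra" and \<alpha> :: "'m::complex_coalgebra"
  shows
  "rep_gen (a * b) \<alpha> = tensor_lift (\<lambda>\<alpha>1 \<alpha>2. rep_gen a \<alpha>1 * rep_gen b \<alpha>2) (comult \<alpha>)"
proof -
  let ?g = "\<lambda>(\<alpha>1 :: 'm) \<alpha>2. rep_gen a \<alpha>1 * rep_gen b \<alpha>2"
  have gen:
    "rep_gen x (\<alpha> + \<beta>) = rep_gen x \<alpha> + rep_gen x \<beta>"
    "rep_gen x (c *\<^sub>C \<alpha>) = c *\<^sub>C rep_gen x \<alpha>" for c and x :: 'a and \<alpha> \<beta> :: 'm
    using cbilinear_rep_gen unfolding cbilinear_def clinear_iff by blast+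
  have g: "cbilinear ?g"
    unfolding cbilinear_def clinear_iff
    by (simp add: gen distrib_left distrib_right mult_scaleC_left mult_scaleC_right)
  obtain s where s: "(\<Sum>(\<alpha>1, \<alpha>2)\<leftarrow>s. \<alpha>1 \<otimes> \<alpha>2) = comult \<alpha>"
    using tensor_sum_list_pure by blast
  let ?v = "\<lambda>s :: ('m \<times> 'm) list. (\<Sum>(\<alpha>1, \<alpha>2)\<leftarrow>s. cpoly_var (a, \<alpha>1) * cpoly_var (b, \<alpha>2))"
  have "rep_rel (cpoly_var (a * b, \<alpha>)) (?v s)"
    unfolding rep_rel_def using s
    by (intro module.span_base[OF module_mult]) (auto simp: rep_relators_def)
  then have "rep_gen (a * b) \<alpha> = abs_rep_alg (?v s)"
    unfolding rep_gen.abs_eq by (simp add: rep_alg.abs_eq_iff)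
  also have "abs_rep_alg (?v s) = (\<Sum>(\<alpha>1, \<alpha>2)\<leftarrow>s. ?g \<alpha>1 \<alpha>2)"
    by (induct s) (auto simp: zero_rep_alg_def plus_rep_alg.abs_eq[symmetric]
        times_rep_alg.abs_eq[symmetric] rep_gen.abs_eq)
  also have "\<dots> = tensor_lift ?g (\<Sum>(\<alpha>1, \<alpha>2)\<leftarrow>s. \<alpha>1 \<otimes> \<alpha>2)"
  proof (induct s)
    case Nil
    show ?case
      using module_hom.zero[OF clinear_tensor_lift[OF g, unfolded linear_iff_module_hom]] by simp
  next
    case (Cons p s)
    then show ?case
      using clinear_tensor_lift[OF g] by (cases p) (simp add: clinear_iff tensor_lift_pure[OF g])
  qed
  finally show ?thesis by (simp add: s)
qed

definition trace_part :: "'m::complex_coalgebra \<Rightarrow> ('a::complex_algebra, 'm) rep_alg set"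
  where "trace_part \<tau> = {rep_gen a \<tau> | a. True}"


section \<open>The induced bracket\<close>

definition biderivation :: "('r::complex_algebra \<Rightarrow> 'r \<Rightarrow> 'r) \<Rightarrow> bool"
  where "biderivation br \<longleftrightarrow> cbilinear br \<and>
    (\<forall>x y z. br x (y * z) = br x y * z + y * br x z) \<and>
    (\<forall>x y z. br (x * y) z = br x z * y + x * br y z)"

text \<open>As the \<open>rep_gen a \<alpha>\<close> generate the algebra, at most one \<open>br\<close> satisfies this.\<close>

definition induced_bracket ::
    "('m::complex_coalgebra \<Rightarrow> 'm \<Rightarrow> complex)
      \<Rightarrow> (('a::complex_algebra, 'a) tensor \<Rightarrow> ('a, 'a) tensor)
      \<Rightarrow> (('a, 'm) rep_alg \<Rightarrow> ('a, 'm) rep_alg \<Rightarrow> ('a, 'm) rep_alg) \<Rightarrow> bool"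
  where "induced_bracket \<nu> D br \<longleftrightarrow> biderivation br \<and>
    (\<forall>a b \<alpha> \<beta>. br (rep_gen a \<alpha>) (rep_gen b \<beta>) =
       tensor_lift (\<lambda>x y. tensor_lift3 (\<lambda>\<beta>1 \<beta>2 \<beta>3. \<nu> \<alpha> \<beta>2 *\<^sub>C (rep_gen x \<beta>1 * rep_gen y \<beta>3)) (comult3 \<beta>))
         (D (a \<otimes> b)))"

end

theory Submission
  imports Defs
begin

text \<open>
  Pairing the middle Sweedler component with the trace element \<open>\<tau>\<close> applies the counit to it, so
  the three-fold comultiplication in the formula for \<open>{a\<^sub>\<tau>, b\<^sub>\<beta>}\<close> collapses to a two-fold one.
  What remains is \<open>x\<^bsub>\<beta>1\<^esub> y\<^bsub>\<beta>2\<^esub> = (x y)\<^sub>\<beta>\<close>, summed over the two legs \<open>x \<otimes> y\<close> of the double bracket of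
  \<open>a\<close> and \<open>b\<close>. Thus \<open>{a\<^sub>\<tau>, b\<^sub>\<beta>} = {a, b}\<^sub>\<beta>\<close> (lemma \<open>induced_bracket_trace\<close>): on generators,
  bracketing with \<open>a\<^sub>\<tau>\<close> acts on the algebra index by \<open>{a, _}\<close> and leaves the coalgebra index alone.

  On a generator \<open>c\<^sub>\<alpha>\<close> the three terms of the Jacobi identity are therefore the values at \<open>\<alpha>\<close> of the
  three terms of the Jacobi identity for \<open>a, b, c\<close> under \<open>{_, _}\<close>. For an arbitrary last argument
  the two sides are the commutator of the derivations \<open>{a\<^sub>\<tau>, _}\<close> and \<open>{b\<^sub>\<tau>, _}\<close> and the
  derivation \<open>{{a\<^sub>\<tau>, b\<^sub>\<tau>}, _}\<close>, and derivations that agree on generators are equal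
  (lemma \<open>derivation_rep_alg_eqI\<close>).
\<close>

section \<open>Linear maps and tensor products\<close>

lemma cbilinear_iff:
  "cbilinear f \<longleftrightarrow>
     (\<forall>x y z. f x (y + z) = f x y + f x z) \<and> (\<forall>c x y. f x (c *\<^sub>C y) = c *\<^sub>C f x y) \<and>
     (\<forall>x y z. f (x + y) z = f x z + f y z) \<and> (\<forall>c x y. f (c *\<^sub>C x) y = c *\<^sub>C f x y)"
  unfolding cbilinear_def clinear_iff by blast

lemma clinear_add: "clinear f \<Longrightarrow> f (x + y) = f x + f y"
  and clinear_scaleC: "clinear f \<Longrightarrow> f (c *\<^sub>C x) = c *\<^sub>C f x"
  by (simp_all add: clinear_iff)

lemma clinear_diff: "clinear f \<Longrightarrow> f (x - y) = f x - f y"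
  by (metis clinear_add diff_add_cancel add_diff_cancel_right')

lemma clinear_zero: "clinear f \<Longrightarrow> f 0 = 0"
  by (metis clinear_diff diff_self)

lemma clinear_tensor_eqI:
  assumes f: "clinear f" and g: "clinear g" and pure: "\<And>x y. f (x \<otimes> y) = g (x \<otimes> y)"
  shows "f t = g t"
proof -
  obtain s where s: "(\<Sum>(x, y)\<leftarrow>s. x \<otimes> y) = t"
    using tensor_sum_list_pure by blast
  have "f (\<Sum>(x, y)\<leftarrow>s. x \<otimes> y) = g (\<Sum>(x, y)\<leftarrow>s. x \<otimes> y)"
    by (induct s) (auto simp: clinear_zero f g clinear_add pure)
  then show ?thesis by (simp add: s)
qed

text \<open>This is what allows a linear map to be moved under a Sweedler sum.\<close>

lemma clinear_tensor_lift_comp: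
  assumes g: "clinear g" and f: "cbilinear f"
  shows "g (tensor_lift f t) = tensor_lift (\<lambda>x y. g (f x y)) t"
proof -
  have gf: "cbilinear (\<lambda>x y. g (f x y))"
    using f g by (simp add: cbilinear_iff clinear_iff)
  have "clinear (\<lambda>t. g (tensor_lift f t))"
    using g clinear_tensor_lift[OF f] by (simp add: clinear_iff)
  then show ?thesis
    using clinear_tensor_lift[OF gf]
    by (rule clinear_tensor_eqI) (simp add: tensor_lift_pure f gf)
qed

lemma tensor_lift_tensor_map:
  assumes h: "cbilinear h" and f: "clinear f" and g: "clinear g"
  shows "tensor_lift h (tensor_map f g t) = tensor_lift (\<lambda>x y. h (f x) (g y)) t"
proof -
  have "cbilinear (\<lambda>x y. f x \<otimes> g y)"
    using f g by (simp add: cbilinear_iff clinear_iff cbilinear_pure_tensor[unfolded cbilinear_iff])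
  then show ?thesis
    unfolding tensor_map_def
    by (simp add: clinear_tensor_lift_comp[OF clinear_tensor_lift[OF h]] tensor_lift_pure[OF h])
qed


section \<open>Contracting the middle factor with the counit\<close>

lemma clinear_rep_gen: "clinear (rep_gen x)"
  using cbilinear_rep_gen unfolding cbilinear_def by blast

lemma clinear_rep_gen_left: "clinear (\<lambda>x. rep_gen x \<beta>)"
  using cbilinear_rep_gen unfolding cbilinear_def by blast

text \<open>The summand depends on \<open>\<beta>2\<close> and \<open>\<beta>3\<close> only through \<open>\<epsilon>(\<beta>2) \<beta>3\<close>, and \<open>\<beta>2 \<otimes> \<beta>3 \<mapsto> \<epsilon>(\<beta>2) \<beta>3\<close>
  undoes the second comultiplication. This leaves the defining relation of the representation
  algebra for a product.\<close>

lemma rep_gen_mult_comult3: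
  fixes x y :: "'a::complex_algebra" and \<beta> :: "'m::complex_coalgebra"
  shows "tensor_lift3 (\<lambda>\<beta>1 \<beta>2 \<beta>3. counit \<beta>2 *\<^sub>C (rep_gen x \<beta>1 * rep_gen y \<beta>3)) (comult3 \<beta>)
    = rep_gen (x * y) \<beta>"
proof -
  let ?E = "tensor_lift (\<lambda>(\<beta>2 :: 'm) \<beta>3. counit \<beta>2 *\<^sub>C (\<beta>3 :: 'm))"
  let ?h = "\<lambda>\<beta>1 s. rep_gen x \<beta>1 * rep_gen y (?E s)"
  have bil: "cbilinear (\<lambda>(\<beta>2 :: 'm) \<beta>3. counit \<beta>2 *\<^sub>C (\<beta>3 :: 'm))"
    by (simp add: cbilinear_iff clinear_add[OF clinear_counit] clinear_scaleC[OF clinear_counit]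
        scaleC_add_left scaleC_add_right scaleC_scaleC scaleC_complex_def mult.commute)
  note linear = clinear_add[OF clinear_rep_gen] clinear_scaleC[OF clinear_rep_gen]
    clinear_add[OF clinear_tensor_lift[OF bil]] clinear_scaleC[OF clinear_tensor_lift[OF bil]]
  have inner: "tensor_lift (\<lambda>\<beta>2 \<beta>3. counit \<beta>2 *\<^sub>C (rep_gen x \<beta>1 * rep_gen y \<beta>3)) = ?h \<beta>1"
    (is "?f = _") for \<beta>1 :: 'm
  proof
    fix s
    have "clinear (\<lambda>\<gamma> :: 'm. rep_gen x \<beta>1 * rep_gen y \<gamma>)"
      by (simp add: clinear_iff linear distrib_left mult_scaleC_right)
    from clinear_tensor_lift_comp[OF this bil, of s] show "?f s = ?h \<beta>1 s"
      by (simp add: linear mult_scaleC_right)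
  qed
  have "cbilinear ?h"
    by (simp add: cbilinear_iff linear distrib_left distrib_right mult_scaleC_left mult_scaleC_right)
  then have "tensor_lift ?h (comult3 \<beta>) = tensor_lift (\<lambda>\<beta>1 \<beta>2. ?h \<beta>1 (comult \<beta>2)) (comult \<beta>)"
    unfolding comult3_def
    by (rule tensor_lift_tensor_map) (simp_all add: clinear_comult, simp add: clinear_iff)
  then show ?thesis
    by (simp add: tensor_lift3_def inner counit_left rep_gen_mult)
qed

text \<open>After the collapse of the comultiplication, each summand \<open>x \<otimes> y\<close> of the double bracket
  contributes \<open>(x y)\<^sub>\<beta>\<close>; as \<open>x \<mapsto> x\<^sub>\<beta>\<close> is linear, the multiplication that turns the double
  bracket into the single bracket can be applied first and the index \<open>\<beta>\<close> attached afterwards.\<close>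

lemma induced_bracket_trace:
  fixes D :: "('a::complex_algebra, 'a) tensor \<Rightarrow> ('a, 'a) tensor"
    and \<tau> \<beta> :: "'m::complex_coalgebra"
  assumes trace: "\<And>\<alpha>. \<nu> \<tau> \<alpha> = counit \<alpha>" and br: "induced_bracket \<nu> D br"
  shows "br (rep_gen a \<tau>) (rep_gen b \<beta>) = rep_gen (single_bracket D a b) \<beta>"
proof -
  have "cbilinear ((*) :: 'a \<Rightarrow> 'a \<Rightarrow> 'a)"
    by (simp add: cbilinear_iff distrib_left distrib_right mult_scaleC_left mult_scaleC_right)
  from clinear_tensor_lift_comp[OF clinear_rep_gen_left[of \<beta>] this, of "D (a \<otimes> b)"]
  show ?thesis
    using br by (simp add: induced_bracket_def trace rep_gen_mult_comult3 single_bracket_def)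
qed


section \<open>Derivations of the representation algebra\<close>

lemma poly_mapping_induct_add [case_names zero add]:
  assumes "P 0" and "\<And>k c p. P p \<Longrightarrow> P (Poly_Mapping.single k c + p)"
  shows "P (p :: 'k \<Rightarrow>\<^sub>0 'c::comm_monoid_add)"
proof (induct p rule: update_induct)
  case const
  show ?case by (rule assms(1))
next
  case (update p k c)
  have "Poly_Mapping.update k c p = Poly_Mapping.single k c + p"
    using update
    by (intro poly_mapping_eqI) (auto simp: lookup_update lookup_add lookup_single when_def in_keys_iff)
  then show ?case using assms(2) update by simp
qed

lemma cpoly_induct [case_names const var add mult]:
  assumes const: "\<And>c. P (cpoly_const c)" and var: "\<And>v. P (cpoly_var v)"
    and add: "\<And>p q. P p \<Longrightarrow> P q \<Longrightarrow> P (p + q)" and mult: "\<And>p q. P p \<Longrightarrow> P q \<Longrightarrow> P (p * q)"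
  shows "P (p :: 'v cpoly)"
proof -
  have one: "P (Poly_Mapping.single 0 1)"
    using const[of 1] by (simp add: cpoly_const_def)
  have power: "P (Poly_Mapping.single (Poly_Mapping.single v n) 1)" for v and n :: nat
  proof (induct n)
    case 0
    show ?case using one by simp
  next
    case (Suc n)
    have "Poly_Mapping.single (Poly_Mapping.single v (Suc n)) 1
        = cpoly_var v * Poly_Mapping.single (Poly_Mapping.single v n) (1 :: complex)"
      by (simp add: cpoly_var_def mult_single flip: single_add)
    then show ?case using mult var Suc by simp
  qed
  have monomial: "P (Poly_Mapping.single m 1)" for m
  proof (induct m rule: poly_mapping_induct_add)
    case zero
    show ?case by (rule one)
  next
    case (add v n m)
    then show ?case using mult[OF power] by (metis mult_single mult_1)
  qed
  show ?thesis
  proof (induct p rule: poly_mapping_induct_add)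
    case zero
    show ?case using const[of 0] by (simp add: cpoly_const_def)
  next
    case (add m c p)
    have "Poly_Mapping.single m c = cpoly_const c * Poly_Mapping.single m 1"
      by (simp add: cpoly_const_def mult_single)
    then show ?case using assms(3) mult const monomial add by simp
  qed
qed

lemma rep_alg_induct [case_names const gen add mult]:
  assumes const: "\<And>c. P (c *\<^sub>C 1)" and gen: "\<And>a \<alpha>. P (rep_gen a \<alpha>)"
    and add: "\<And>x y. P x \<Longrightarrow> P y \<Longrightarrow> P (x + y)" and mult: "\<And>x y. P x \<Longrightarrow> P y \<Longrightarrow> P (x * y)"
  shows "P (x :: ('a::complex_algebra, 'm::complex_coalgebra) rep_alg)"
proof -
  have "P (abs_rep_alg p)" for p
  proof (induct p rule: cpoly_induct)
    case (const c)
    then show ?case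
      using assms(1)[of c] by (simp add: one_rep_alg_def scaleC_rep_alg.abs_eq)
  next
    case (var v)
    then show ?case using gen[of "fst v" "snd v"] by (simp add: rep_gen.abs_eq)
  next
    case (add p q)
    then show ?case using assms(3) by (simp flip: plus_rep_alg.abs_eq)
  next
    case (mult p q)
    then show ?case using assms(4) by (simp flip: times_rep_alg.abs_eq)
  qed
  then show ?thesis by (metis Quotient3_abs_rep[OF Quotient3_rep_alg])
qed

definition derivation :: "('r::complex_algebra \<Rightarrow> 'r) \<Rightarrow> bool"
  where "derivation d \<longleftrightarrow> clinear d \<and> (\<forall>x y. d (x * y) = d x * y + x * d y)"

lemma derivation_biderivation: "biderivation br \<Longrightarrow> derivation (br x)"
  by (auto simp: biderivation_def derivation_def cbilinear_def)

lemma derivation_commutator: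
  assumes "derivation d" and "derivation e"
  shows "derivation (\<lambda>x. d (e x) - e (d x))"
  using assms
  by (simp add: derivation_def clinear_iff algebra_simps scaleC_add_right
      module.scale_right_diff_distrib[OF vector_space_scaleC[folded module_iff_vector_space]])

lemma derivation_one:
  fixes d :: "('a::complex_algebra, 'm::complex_coalgebra) rep_alg \<Rightarrow> ('a, 'm) rep_alg"
  assumes "derivation d"
  shows "d 1 = 0"
proof -
  have "d (1 * 1) = d 1 * 1 + 1 * d 1"
    using assms unfolding derivation_def by blast
  then show ?thesis by simp
qed

lemma derivation_rep_alg_eqI:
  fixes d e :: "('a::complex_algebra, 'm::complex_coalgebra) rep_alg \<Rightarrow> ('a, 'm) rep_alg"
  assumes d: "derivation d" and e: "derivation e"
    and gen: "\<And>a \<alpha>. d (rep_gen a \<alpha>) = e (rep_gen a \<alpha>)"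
  shows "d x = e x"
proof (induct x rule: rep_alg_induct)
  case (const c)
  then show ?case
    using d e derivation_one[OF d] derivation_one[OF e]
    by (simp add: derivation_def clinear_scaleC)
qed (use d e in \<open>simp_all add: gen derivation_def clinear_add\<close>)


section \<open>The Jacobi identity\<close>

theorem proposition33:
  fixes D :: "('a::complex_algebra, 'a) tensor \<Rightarrow> ('a, 'a) tensor"
    and \<nu> :: "'m::complex_coalgebra \<Rightarrow> 'm \<Rightarrow> complex"
    and \<tau> :: 'm
    and br :: "('a, 'm) rep_alg \<Rightarrow> ('a, 'm) rep_alg \<Rightarrow> ('a, 'm) rep_alg"
  assumes "modified_double_poisson_bracket D"
    and "coalgebra_form \<nu> \<tau>"
    and "induced_bracket \<nu> D br"
  shows "(\<forall>x \<in> trace_part \<tau>. \<forall>y \<in> trace_part \<tau>. \<forall>z.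
            br x (br y z) - br y (br x z) = br (br x y) z) \<and>
         (\<forall>a b c \<alpha>.
            br (rep_gen a \<tau>) (br (rep_gen b \<tau>) (rep_gen c \<alpha>))
              - br (rep_gen b \<tau>) (br (rep_gen a \<tau>) (rep_gen c \<alpha>))
            = br (br (rep_gen a \<tau>) (rep_gen b \<tau>)) (rep_gen c \<alpha>))"
proof -
  note trace = induced_bracket_trace[of \<nu> \<tau>, OF coalgebra_form.trace[OF assms(2)] assms(3)]
  have der: "derivation (br x)" for x
    using assms(3) by (simp add: induced_bracket_def derivation_biderivation)
  have jacobi: "br (rep_gen a \<tau>) (br (rep_gen b \<tau>) z) - br (rep_gen b \<tau>) (br (rep_gen a \<tau>) z)
      = br (br (rep_gen a \<tau>) (rep_gen b \<tau>)) z" for a b z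
  proof (rule derivation_rep_alg_eqI[OF derivation_commutator[OF der der] der])
    fix c \<alpha>
    show "br (rep_gen a \<tau>) (br (rep_gen b \<tau>) (rep_gen c \<alpha>))
        - br (rep_gen b \<tau>) (br (rep_gen a \<tau>) (rep_gen c \<alpha>))
      = br (br (rep_gen a \<tau>) (rep_gen b \<tau>)) (rep_gen c \<alpha>)"
      using modified_double_poisson_bracket.jacobi[OF assms(1), of a b c]
      by (simp add: trace flip: clinear_diff[OF clinear_rep_gen_left])
  qed
  then show ?thesis by (auto simp: trace_part_def)
qed

end
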